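(* Let $G$ be an $r$-regular graph on $m$ vertices and $K_n$ a complete graph on $n$ vertices, where $r\le n-1$. Then the sparing number of the edge corona $G\diamond K_n$ is $\frac{1}{4}rmn(n+1)$.
   Context: All graphs are simple, finite and have no isolated vertices. $\mathbb{N}_0$ is the set of non-negative integers, $\mathcal{P}(\mathbb{N}_0)$ is its power set, and the sum set of $A,B\subseteq\mathbb{N}_0$ is $A+B=\{a+b: a\in A,\ b\in B\}$. All sets used as labels are finite. An integer additive set-indexer (IASI) of a graph $G$ is an injective function $f:V(G)\to\mathcal{P}(\mathbb{N}_0)$ such that the induced function $f^+:E(G)\to\mathcal{P}(\mathbb{N}_0)$, $f^+(uv)=f(u)+f(v)$, is also injective. It is a weak IASI if $|f^+(uv)|=\max(|f(u)|,|f(v)|)$ for every edge $uv\in E(G)$. An edge $e$ is mono-indexed if $|f^+(e)|=1$. The sparing number $\varphi(G)$ is the minimum number of mono-indexed edges required for $G$ to admit a weak IASI, i.e. the minimum of the number of mono-indexed edges over all weak IASIs of $G$. Edge corona: if $G_1$ has $m_1$ edges, $G_1\diamond G_2$ is the graph obtained from $G_1$ by taking $m_1$ disjoint copies of $G_2$ (one for each edge of $G_1$) and joining both end vertices of the $i$-th edge of $G_1$ to every vertex of the $i$-th copy of $G_2$. *)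

theory Defs
  imports Complex_Main "HOL-Library.Ramsey" "HOL-Library.Set_Algebras"
begin

section \<open>Graphs\<close>

text \<open>Undirected graphs; an edge is the two-element set of its end vertices.\<close>

record 'a ugraph =
  verts :: "'a set"
  edges :: "'a set set"

text \<open>Every graph is finite, simple and has no isolated vertices.\<close>

definition graph :: "'a ugraph \<Rightarrow> bool" where
  "graph G \<longleftrightarrow>
     finite (verts G) \<and> edges G \<subseteq> nsets (verts G) 2 \<and> (\<forall>v\<in>verts G. \<exists>e\<in>edges G. v \<in> e)"

definition degree :: "'a ugraph \<Rightarrow> 'a \<Rightarrow> nat" where
  "degree G v = card {e \<in> edges G. v \<in> e}"

definition regular :: "nat \<Rightarrow> 'a ugraph \<Rightarrow> bool" where
  "regular r G \<longleftrightarrow> (\<forall>v\<in>verts G. degree G v = r)"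

definition complete_graph :: "'a ugraph \<Rightarrow> bool" where
  "complete_graph G \<longleftrightarrow> edges G = nsets (verts G) 2"

text \<open>
  The copy of \<open>H\<close> belonging to the edge \<open>e\<close> of \<open>G\<close> has the vertices \<open>Inr (e, w)\<close> for
  \<open>w\<close> in \<open>H\<close>. The three parts of the edge set are the edges of \<open>G\<close>, those of the copies of \<open>H\<close>,
  and those joining both ends of \<open>e\<close> to the copy belonging to \<open>e\<close>.
\<close>

definition edge_corona :: "'a ugraph \<Rightarrow> 'b ugraph \<Rightarrow> ('a + 'a set \<times> 'b) ugraph"
    (infixl \<open>\<diamondop>\<close> 65) where
  "G \<diamondop> H =
     \<lparr>verts = Inl ` verts G \<union> Inr ` (edges G \<times> verts H),
      edges = {Inl ` e | e. e \<in> edges G}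
            \<union> {(\<lambda>w. Inr (e, w)) ` d | e d. e \<in> edges G \<and> d \<in> edges H}
            \<union> {{Inl v, Inr (e, w)} | e v w. e \<in> edges G \<and> v \<in> e \<and> w \<in> verts H}\<rparr>"

lemma graph_edge_corona:
  assumes "graph G" and "graph H"
  shows "graph (G \<diamondop> H)"
proof -
  have G: "finite (verts G)" "edges G \<subseteq> nsets (verts G) 2" "\<forall>v\<in>verts G. \<exists>e\<in>edges G. v \<in> e"
    and H: "finite (verts H)" "edges H \<subseteq> nsets (verts H) 2" "\<forall>v\<in>verts H. \<exists>e\<in>edges H. v \<in> e"
    using assms by (auto simp: graph_def)
  have finE: "finite (edges G)"
    using G(1,2) finite_imp_finite_nsets finite_subset by blast
  have "edges (G \<diamondop> H) \<subseteq> nsets (verts (G \<diamondop> H)) 2"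
  proof
    fix x assume "x \<in> edges (G \<diamondop> H)"
    then consider (old) e where "x = Inl ` e" "e \<in> edges G"
      | (copy) e d where "x = (\<lambda>w. Inr (e, w)) ` d" "e \<in> edges G" "d \<in> edges H"
      | (join) e v w where "x = {Inl v, Inr (e, w)}" "e \<in> edges G" "v \<in> e" "w \<in> verts H"
      unfolding edge_corona_def ugraph.simps by (elim UnE CollectE exE conjE) assumption+
    then show "x \<in> nsets (verts (G \<diamondop> H)) 2"
    proof cases
      case old
      with G(2) have "e \<subseteq> verts G" "finite e" "card e = 2"
        by (auto simp: nsets_def)
      moreover have "card (Inl ` e :: ('a + 'a set \<times> 'b) set) = card e"
        by (rule card_image) simp
      ultimately show ?thesis
        unfolding old(1) edge_corona_def nsets_def by (simp add: image_mono le_supI1)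
    next
      case copy
      with H(2) have "d \<subseteq> verts H" "finite d" "card d = 2"
        by (auto simp: nsets_def)
      moreover have "card ((\<lambda>w. Inr (e, w)) ` d :: ('a + 'a set \<times> 'b) set) = card d"
        by (rule card_image) (simp add: inj_on_def)
      moreover have "(\<lambda>w. Inr (e, w)) ` d \<subseteq> verts (G \<diamondop> H)"
        using \<open>d \<subseteq> verts H\<close> copy(2) by (auto simp: edge_corona_def)
      ultimately show ?thesis
        unfolding copy(1) nsets_def by simp
    next
      case join
      then have "v \<in> verts G"
        using G(2) unfolding nsets_def by blast
      with join show ?thesis
        by (simp add: edge_corona_def)
    qed
  qed
  moreover have "\<exists>d\<in>edges (G \<diamondop> H). x \<in> d" if "x \<in> verts (G \<diamondop> H)" for x
  proof -
    from that consider (old) v where "x = Inl v" "v \<in> verts G"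
      | (copy) e w where "x = Inr (e, w)" "e \<in> edges G" "w \<in> verts H"
      by (auto simp: edge_corona_def)
    then show ?thesis
    proof cases
      case old
      with G(3) obtain e where "e \<in> edges G" "v \<in> e" by blast
      then have "Inl ` e \<in> edges (G \<diamondop> H)" "x \<in> Inl ` e"
        using old by (auto simp: edge_corona_def)
      then show ?thesis by (rule bexI[rotated])
    next
      case copy
      with H(3) obtain d where "d \<in> edges H" "w \<in> d" by blast
      then have "(\<lambda>w. Inr (e, w)) ` d \<in> {(\<lambda>w. Inr (e, w)) ` d | e d. e \<in> edges G \<and> d \<in> edges H}"
        using copy(2) by (intro CollectI exI conjI) (rule refl)
      then have "(\<lambda>w. Inr (e, w)) ` d \<in> edges (G \<diamondop> H)"
        unfolding edge_corona_def ugraph.simps by (rule UnI1[OF UnI2])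
      moreover have "x \<in> (\<lambda>w. Inr (e, w)) ` d"
        using copy(1) \<open>w \<in> d\<close> by simp
      ultimately show ?thesis by (rule bexI[rotated])
    qed
  qed
  moreover have "finite (verts (G \<diamondop> H))"
    using G(1) H(1) finE by (simp add: edge_corona_def)
  ultimately show ?thesis
    by (simp add: graph_def)
qed

section \<open>Integer additive set-indexers\<close>

text \<open>
  The induced edge function \<open>f\<^sup>+\<close>. Sets of numbers are added elementwise, and since this sum is
  commutative the label of an edge can be written as a sum over its (unordered) end vertices.
\<close>

definition induced :: "('a \<Rightarrow> nat set) \<Rightarrow> 'a set \<Rightarrow> nat set" where
  "induced f e = (\<Sum>v\<in>e. f v)"

lemma induced_edge: "u \<noteq> v \<Longrightarrow> induced f {u, v} = f u + f v"
  by (simp add: induced_def)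

definition IASI :: "'a ugraph \<Rightarrow> ('a \<Rightarrow> nat set) \<Rightarrow> bool" where
  "IASI G f \<longleftrightarrow>
     (\<forall>v\<in>verts G. finite (f v)) \<and> inj_on f (verts G) \<and> inj_on (induced f) (edges G)"

definition weak_IASI :: "'a ugraph \<Rightarrow> ('a \<Rightarrow> nat set) \<Rightarrow> bool" where
  "weak_IASI G f \<longleftrightarrow>
     IASI G f \<and>
     (\<forall>u v. {u, v} \<in> edges G \<longrightarrow> card (induced f {u, v}) = max (card (f u)) (card (f v)))"

definition mono_indexed :: "('a \<Rightarrow> nat set) \<Rightarrow> 'a set \<Rightarrow> bool" where
  "mono_indexed f e \<longleftrightarrow> card (induced f e) = 1"

definition sparing_number :: "'a ugraph \<Rightarrow> nat" where
  "sparing_number G =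
     (LEAST k. \<exists>f. weak_IASI G f \<and> k = card {e \<in> edges G. mono_indexed f e})"

end

theory Submission
  imports Defs "HOL-Library.Nat_Bijection"
begin

text \<open>
  In a weak IASI of a graph all labels are nonempty, and of two adjacent vertices at least one has
  a singleton label: the sum of two sets with at least two elements each is strictly larger than
  both. Hence the vertices whose label is not a singleton form an independent set, and an edge is
  mono-indexed exactly when both ends lie outside this set (\<open>mono_indexed_iff\<close>). Conversely
  every independent set arises in this way (\<open>weak_IASI_of_independent\<close>). So the sparing number is
  the least number of edges missed by an independent set.

  For \<open>G \<diamondop> K\<^sub>n\<close> this problem splits into local ones. Each edge \<open>e\<close> of \<open>G\<close>, together with its copy
  of \<open>K\<^sub>n\<close>, spans a complete graph on \<open>n + 2\<close> vertices, and every edge of the corona lies in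
  exactly one of these cliques (\<open>edges_edge_corona\<close>, \<open>disjoint_edge_blocks\<close>). An independent set
  has at most one vertex in a clique and therefore misses at least \<open>n + 1 choose 2\<close> of its edges.
  As \<open>n\<close> is positive, the bound is attained in all cliques at once, by choosing one vertex in
  every copy of \<open>K\<^sub>n\<close>. The sparing number is thus \<open>n + 1 choose 2\<close> times the number of edges of
  \<open>G\<close>, and an \<open>r\<close>-regular graph on \<open>m\<close> vertices has \<open>r m / 2\<close> edges.
\<close>

section \<open>Sum sets\<close>

lemma Min_set_plus:
  fixes A B :: "nat set"
  assumes "finite A" "A \<noteq> {}" "finite B" "B \<noteq> {}"
  shows "Min (A + B) = Min A + Min B"
proof (rule Min_eqI)
  show "finite (A + B)" using assms by (intro finite_set_plus)
  show "Min A + Min B \<in> A + B" using assms by (intro set_plus_intro) auto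
  show "Min A + Min B \<le> x" if "x \<in> A + B" for x
    using that assms by (auto elim!: set_plus_elim intro!: add_mono)
qed

text \<open>
  The translate of \<open>B\<close> by the least element of \<open>A\<close> does not reach the largest element of the
  sum set.
\<close>

lemma card_set_plus_greater:
  fixes A B :: "nat set"
  assumes "2 \<le> card A" "finite B" "B \<noteq> {}"
  shows "card B < card (A + B)"
proof -
  have A: "finite A" "A \<noteq> {}"
    using assms(1) by (auto intro: card_ge_0_finite)
  have "Min A \<noteq> Max A"
  proof
    assume "Min A = Max A"
    then have "A \<subseteq> {Min A}"
      using A(1) by (metis Max_ge Min_le antisym singletonI subsetI)
    then show False
      using assms(1) card_mono[of "{Min A}" A] by simp
  qed
  then have less: "Min A < Max A"
    using A by (metis Max_in Min_le nat_less_le)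
  have "Max A + Max B \<notin> (+) (Min A) ` B"
    using less Max_ge[OF assms(2)] by fastforce
  then have "card (insert (Max A + Max B) ((+) (Min A) ` B)) = Suc (card B)"
    using assms(2) by (simp add: card_image)
  moreover have "insert (Max A + Max B) ((+) (Min A) ` B) \<subseteq> A + B"
    using A assms(2,3) by (blast intro: Max_in Min_in)
  then have "card (insert (Max A + Max B) ((+) (Min A) ` B)) \<le> card (A + B)"
    by (rule card_mono[OF finite_set_plus[OF A(1) assms(2)]])
  ultimately show ?thesis by linarith
qed

section \<open>Edges of graphs\<close>

lemma edge_ends:
  assumes "graph G" "{u, v} \<in> edges G"
  shows "u \<in> verts G" "v \<in> verts G" "u \<noteq> v"
proof -
  have "{u, v} \<in> nsets (verts G) 2"
    using assms unfolding graph_def by blast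
  then show "u \<in> verts G" "v \<in> verts G" "u \<noteq> v" by auto
qed

lemma edge_set:
  assumes "graph G" "e \<in> edges G"
  shows "e \<subseteq> verts G" "finite e" "card e = 2"
  using assms unfolding graph_def nsets_def by blast+

lemma finite_edges: "graph G \<Longrightarrow> finite (edges G)"
  using finite_imp_finite_nsets finite_subset unfolding graph_def by blast

lemma regular_handshake:
  assumes "graph G" "regular r G"
  shows "r * card (verts G) = 2 * card (edges G)"
proof -
  have fin: "finite (verts G)" "finite (edges G)"
    using assms(1) finite_edges by (auto simp: graph_def)
  have "\<forall>e\<in>edges G. card {v \<in> verts G. v \<in> e} = 2"
  proof
    fix e assume "e \<in> edges G"
    then have "e \<subseteq> verts G" "card e = 2"
      using edge_set[OF assms(1)] by blast+
    moreover from this have "{v \<in> verts G. v \<in> e} = e" by blast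
    ultimately show "card {v \<in> verts G. v \<in> e} = 2" by simp
  qed
  then have "(\<Sum>v\<in>verts G. card {e \<in> edges G. v \<in> e}) = 2 * card (edges G)"
    by (rule sum_multicount[OF fin])
  moreover have "(\<Sum>v\<in>verts G. card {e \<in> edges G. v \<in> e}) = r * card (verts G)"
    using assms(2) unfolding regular_def degree_def by simp
  ultimately show ?thesis by simp
qed

section \<open>Weak IASIs and independent sets\<close>

text \<open>
  An empty label would force the label of a neighbour to be empty as well, against injectivity; and
  there is a neighbour, since graphs have no isolated vertices.
\<close>

lemma weak_IASI_nonempty:
  assumes "graph G" "weak_IASI G f" "v \<in> verts G"
  shows "f v \<noteq> {}"
proof
  assume empty: "f v = {}"
  obtain e where e: "e \<in> edges G" "v \<in> e" "e \<in> nsets (verts G) 2"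
    using assms(1,3) unfolding graph_def by blast
  then obtain u where u: "e = {v, u}" "u \<in> verts G" "u \<noteq> v"
    by (auto simp: nsets_2_eq)
  have "f v + f u = {}"
    using empty by (auto elim: set_plus_elim)
  then have "card (induced f {v, u}) = 0"
    using u(3) by (simp add: induced_edge)
  then have "card (f u) = 0"
    using assms(2) e(1) u(1) unfolding weak_IASI_def by (metis max_0L card.empty empty)
  then have "f u = f v"
    using assms(2) u(2) empty unfolding weak_IASI_def IASI_def by auto
  then show False
    using assms(2,3) u(2,3) unfolding weak_IASI_def IASI_def inj_on_def by blast
qed

lemma weak_IASI_adjacent:
  assumes "graph G" "weak_IASI G f" "{u, v} \<in> edges G"
  shows "card (f u) = 1 \<or> card (f v) = 1"
proof (rule ccontr)
  assume not_single: "\<not> ?thesis"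
  note uv = edge_ends[OF assms(1,3)]
  have fin: "finite (f u)" "finite (f v)"
    using assms(2) uv unfolding weak_IASI_def IASI_def by auto
  have ne: "f u \<noteq> {}" "f v \<noteq> {}"
    using weak_IASI_nonempty[OF assms(1,2)] uv by auto
  have "card (f u) \<noteq> 0" "card (f v) \<noteq> 0"
    using fin ne by auto
  with not_single have "2 \<le> card (f u)" "2 \<le> card (f v)"
    by linarith+
  then have "card (f v) < card (f u + f v)" "card (f u) < card (f v + f u)"
    using fin ne by (auto intro: card_set_plus_greater)
  then have "max (card (f u)) (card (f v)) < card (induced f {u, v})"
    using uv(3) by (simp add: induced_edge add.commute)
  then show False
    using assms(2,3) unfolding weak_IASI_def by auto
qed

lemma mono_indexed_iff:
  assumes "graph G" "weak_IASI G f" "{u, v} \<in> edges G"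
  shows "mono_indexed f {u, v} \<longleftrightarrow> card (f u) = 1 \<and> card (f v) = 1"
proof -
  have "card (f u) \<noteq> 0" "card (f v) \<noteq> 0"
    using assms(2) weak_IASI_nonempty[OF assms(1,2)] edge_ends[OF assms(1,3)]
    unfolding weak_IASI_def IASI_def by auto
  moreover have "card (induced f {u, v}) = max (card (f u)) (card (f v))"
    using assms(2,3) unfolding weak_IASI_def by blast
  ultimately show ?thesis
    unfolding mono_indexed_def by linarith
qed

text \<open>
  Number the vertices and give the \<open>i\<close>-th one a label with least element \<open>2\<^sup>i\<close>. The least
  element of an edge label is then the number whose binary digits mark the two ends, so that edge
  labels are distinct whatever the remaining elements of the vertex labels are. One additional
  element at the vertices of \<open>I\<close> makes precisely their labels non-singletons.
\<close>

lemma weak_IASI_of_independent: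
  assumes "graph G" and indep: "\<And>u v. {u, v} \<in> edges G \<Longrightarrow> u \<notin> I \<or> v \<notin> I"
  obtains f where "weak_IASI G f" "\<And>v. card (f v) = 1 \<longleftrightarrow> v \<notin> I"
proof -
  have "finite (verts G)"
    using assms(1) by (simp add: graph_def)
  then obtain h :: "'a \<Rightarrow> nat" where h: "inj_on h (verts G)"
    using finite_imp_inj_to_nat_seg by metis
  define f where "f v = (if v \<in> I then {2 ^ h v, 2 ^ h v + 1} else {2 ^ h v :: nat})" for v
  have fin: "finite (f v)" and ne: "f v \<noteq> {}" and Min_f: "Min (f v) = 2 ^ h v"
    and card_f: "card (f v) = (if v \<in> I then 2 else 1)" for v
    by (auto simp: f_def)
  have edgeE: thesis
    if "e \<in> edges G" "\<And>u v. \<lbrakk>e = {u, v}; u \<in> verts G; v \<in> verts G; u \<noteq> v\<rbrakk> \<Longrightarrow> thesis"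
    for e thesis
    using that assms(1) unfolding graph_def nsets_2_eq by blast
  have Min_induced: "Min (induced f e) = set_encode (h ` e)" if "e \<in> edges G" for e
    using that
  proof (rule edgeE)
    fix u v assume e: "e = {u, v}" "u \<in> verts G" "v \<in> verts G" "u \<noteq> v"
    then have "h u \<noteq> h v"
      using h by (auto dest: inj_onD)
    then show ?thesis
      using e(1,4) by (simp add: induced_edge Min_set_plus fin ne Min_f set_encode_def)
  qed
  have "inj_on f (verts G)"
  proof (rule inj_onI)
    fix u v assume uv: "u \<in> verts G" "v \<in> verts G" "f u = f v"
    then have "(2::nat) ^ h u = 2 ^ h v"
      by (metis Min_f)
    then show "u = v"
      using h uv by (auto dest: inj_onD)
  qed
  moreover have "inj_on (induced f) (edges G)"
  proof (rule inj_onI)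
    fix d e assume de: "d \<in> edges G" "e \<in> edges G" "induced f d = induced f e"
    have sub: "d \<subseteq> verts G" "e \<subseteq> verts G" "finite d" "finite e"
      using de edge_set[OF assms(1)] by blast+
    have "set_encode (h ` d) = set_encode (h ` e)"
      using de Min_induced by metis
    then have "h ` d = h ` e"
      using sub by (simp add: set_encode_eq)
    then show "d = e"
      using inj_on_image_eq_iff[OF h] sub by blast
  qed
  moreover have "card (induced f {u, v}) = max (card (f u)) (card (f v))"
    if "{u, v} \<in> edges G" for u v
  proof -
    have "u \<noteq> v"
      using edge_ends[OF assms(1) that] by blast
    moreover have "u \<notin> I \<or> v \<notin> I"
      using indep that by blast
    moreover have "{a} + B = (+) a ` B" "B + {a} = (+) a ` B" for a :: nat and B
      by (auto simp: set_plus_def)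
    ultimately have "induced f {u, v} = (+) (2 ^ h u) ` f v \<and> u \<notin> I
                   \<or> induced f {u, v} = (+) (2 ^ h v) ` f u \<and> v \<notin> I"
      by (auto simp: induced_edge f_def)
    then show ?thesis
      by (auto simp: card_image card_f)
  qed
  ultimately have "weak_IASI G f"
    unfolding weak_IASI_def IASI_def using fin by blast
  then show thesis
    using that card_f by auto
qed

section \<open>The cliques of an edge corona with a complete graph\<close>

definition block :: "'b ugraph \<Rightarrow> 'a set \<Rightarrow> ('a + 'a set \<times> 'b) set" where
  "block K e = Inl ` e \<union> (\<lambda>w. Inr (e, w)) ` verts K"

lemma Inl_in_block [simp]: "Inl v \<in> block K e \<longleftrightarrow> v \<in> e"
  and Inr_in_block [simp]: "Inr (d, w) \<in> block K e \<longleftrightarrow> d = e \<and> w \<in> verts K"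
  by (auto simp: block_def)

lemma finite_block:
  "finite e \<Longrightarrow> finite (verts K) \<Longrightarrow> finite (block K e)"
  by (simp add: block_def)

lemma card_block:
  assumes "finite e" "finite (verts K)"
  shows "card (block K e) = card e + card (verts K)"
  unfolding block_def using assms
  by (subst card_Un_disjoint) (auto simp: card_image inj_on_def)

text \<open>
  Pairs of vertices in a block are of three kinds, and these are the three kinds of edges of the
  corona: two ends of \<open>e\<close>, two vertices of the copy (adjacent as \<open>K\<close> is complete), or one of each.
\<close>

lemma edges_edge_corona:
  assumes "graph G" "complete_graph K"
  shows "edges (G \<diamondop> K) = (\<Union>e\<in>edges G. nsets (block K e) 2)"
proof (intro equalityI subsetI)
  fix d assume "d \<in> edges (G \<diamondop> K)"
  then consider (old) e where "d = Inl ` e" "e \<in> edges G"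
    | (copy) e c where "d = (\<lambda>w. Inr (e, w)) ` c" "e \<in> edges G" "c \<in> edges K"
    | (join) e v w where "d = {Inl v, Inr (e, w)}" "e \<in> edges G" "v \<in> e" "w \<in> verts K"
    unfolding edge_corona_def ugraph.simps by (elim UnE CollectE exE conjE) assumption+
  then show "d \<in> (\<Union>e\<in>edges G. nsets (block K e) 2)"
  proof cases
    case old
    then obtain u v where "e = {u, v}" "u \<noteq> v"
      using edge_set(3)[OF assms(1) old(2)] by (auto simp: card_2_iff)
    with old(1) have "d \<in> nsets (block K e) 2" by simp
    with old(2) show ?thesis by blast
  next
    case copy
    then obtain u v where "c = {u, v}" "u \<noteq> v" "u \<in> verts K" "v \<in> verts K"
      using assms(2) unfolding complete_graph_def nsets_2_eq by blast
    with copy(1) have "d \<in> nsets (block K e) 2" by simp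
    with copy(2) show ?thesis by blast
  next
    case join
    then have "d \<in> nsets (block K e) 2" by simp
    with join(2) show ?thesis by blast
  qed
next
  fix d assume "d \<in> (\<Union>e\<in>edges G. nsets (block K e) 2)"
  then obtain e x y where e: "e \<in> edges G" and d: "d = {x, y}" "x \<noteq> y"
    and xy: "x \<in> block K e" "y \<in> block K e"
    by (auto simp: nsets_2_eq)
  have join: "{Inl v, Inr (e, w)} \<in> edges (G \<diamondop> K)" if "v \<in> e" "w \<in> verts K" for v w
    using e that unfolding edge_corona_def by auto
  have "card e = 2"
    using edge_set[OF assms(1) e] by auto
  then have old: "{Inl u, Inl v} \<in> edges (G \<diamondop> K)" if "u \<in> e" "v \<in> e" "u \<noteq> v" for u v
  proof -
    have "e = {u, v}"
      using that \<open>card e = 2\<close> by (auto simp: card_2_iff)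
    then have "{Inl u, Inl v} = Inl ` e" by simp
    then show ?thesis
      unfolding edge_corona_def ugraph.simps using e
      by (intro UnI1[OF UnI1] CollectI exI conjI)
  qed
  have copy: "{Inr (e, u), Inr (e, v)} \<in> edges (G \<diamondop> K)"
    if "u \<in> verts K" "v \<in> verts K" "u \<noteq> v" for u v
  proof -
    have "{u, v} \<in> edges K"
      using that assms(2) unfolding complete_graph_def by simp
    moreover have "{Inr (e, u), Inr (e, v)} = (\<lambda>w. Inr (e, w)) ` {u, v}" by simp
    ultimately show ?thesis
      unfolding edge_corona_def ugraph.simps using e
      by (intro UnI1[OF UnI2] CollectI exI conjI)
  qed
  show "d \<in> edges (G \<diamondop> K)"
    using xy d unfolding block_def
    by (elim UnE imageE) (auto intro: old join copy simp: insert_commute)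
qed

text \<open>
  Two blocks share only vertices of \<open>G\<close>, and two common vertices of \<open>G\<close> would be both ends of the
  two edges that the blocks belong to.
\<close>

lemma disjoint_edge_blocks:
  assumes "card d = 2" "card e = 2" "d \<noteq> e"
  shows "nsets (block K d) 2 \<inter> nsets (block K e) 2 = {}"
proof (rule ccontr)
  assume "\<not> ?thesis"
  then obtain x y where xy: "x \<noteq> y"
      "x \<in> block K d" "y \<in> block K d" "x \<in> block K e" "y \<in> block K e"
    by (auto simp: nsets_2_eq doubleton_eq_iff)
  then obtain u v where "x = Inl u" "y = Inl v"
    using assms(3) by (auto simp: block_def)
  with xy have "u \<noteq> v" "u \<in> d" "v \<in> d" "u \<in> e" "v \<in> e" by auto
  then have "d = {u, v}" "e = {u, v}"
    using assms(1,2) by (auto simp: card_2_iff)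
  with assms(3) show False by simp
qed

section \<open>The sparing number of the corona\<close>

text \<open>
  The cliques partition the edges of the corona, and within a clique the mono-indexed edges are the
  pairs of vertices with singleton labels.
\<close>

lemma card_mono_indexed_edge_corona:
  assumes "graph G" "graph K" "complete_graph K" "weak_IASI (G \<diamondop> K) f"
  shows "card {d \<in> edges (G \<diamondop> K). mono_indexed f d}
       = (\<Sum>e\<in>edges G. card {x \<in> block K e. card (f x) = 1} choose 2)"
proof -
  have corona: "graph (G \<diamondop> K)"
    using assms(1,2) by (rule graph_edge_corona)
  note finE = finite_edges[OF assms(1)]
  note e2 = edge_set(2,3)[OF assms(1)]
  have finK: "finite (verts K)"
    using assms(2) by (simp add: graph_def)
  let ?S = "\<lambda>e. {x \<in> block K e. card (f x) = 1}"
  have mono_iff: "d \<in> nsets (?S e) 2 \<longleftrightarrow> d \<in> nsets (block K e) 2 \<and> mono_indexed f d"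
    if e: "e \<in> edges G" for d e
  proof -
    have in_block: "d \<in> nsets (block K e) 2" if "d \<in> nsets (?S e) 2"
      using that unfolding nsets_def by blast
    have "d \<in> nsets (?S e) 2 \<longleftrightarrow> mono_indexed f d" if d: "d \<in> nsets (block K e) 2"
    proof -
      obtain x y where xy: "d = {x, y}" "x \<noteq> y"
        using d by (auto simp: nsets_2_eq)
      have "d \<in> edges (G \<diamondop> K)"
        unfolding edges_edge_corona[OF assms(1,3)] using e d by blast
      then have "mono_indexed f d \<longleftrightarrow> card (f x) = 1 \<and> card (f y) = 1"
        using mono_indexed_iff[OF corona assms(4)] xy(1) by simp
      then show ?thesis
        using d xy by auto
    qed
    with in_block show ?thesis by blast
  qed
  have "{d \<in> edges (G \<diamondop> K). mono_indexed f d} = (\<Union>e\<in>edges G. nsets (?S e) 2)"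
    unfolding edges_edge_corona[OF assms(1,3)] using mono_iff by blast
  moreover have "card (\<Union>e\<in>edges G. nsets (?S e) 2) = (\<Sum>e\<in>edges G. card (nsets (?S e) 2))"
  proof (rule card_UN_disjoint[OF finE])
    show "\<forall>e\<in>edges G. finite (nsets (?S e) 2)"
      using e2 finK by (auto intro!: finite_imp_finite_nsets simp: finite_block)
    have "nsets (?S e) 2 \<subseteq> nsets (block K e) 2" for e
      by (rule nsets_mono) auto
    then show "\<forall>d\<in>edges G. \<forall>e\<in>edges G. d \<noteq> e \<longrightarrow> nsets (?S d) 2 \<inter> nsets (?S e) 2 = {}"
      using disjoint_edge_blocks e2 by blast
  qed
  ultimately show ?thesis
    by (simp add: card_nsets)
qed

text \<open>
  Omitting one vertex from each clique gives the value. It has to be a vertex of the copy: then the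
  omitted vertices of different cliques are not adjacent, whereas a vertex of \<open>G\<close> would be omitted
  from all cliques around it.
\<close>

lemma sparing_number_edge_corona_complete:
  assumes "graph G" "graph K" "complete_graph K" "verts K \<noteq> {}"
  shows "sparing_number (G \<diamondop> K) = card (edges G) * (Suc (card (verts K)) choose 2)"
  unfolding sparing_number_def
proof (rule Least_equality)
  let ?n = "card (verts K)"
  have corona: "graph (G \<diamondop> K)"
    using assms(1,2) by (rule graph_edge_corona)
  note e2 = edge_set(2,3)[OF assms(1)]
  have finK: "finite (verts K)"
    using assms(2) by (simp add: graph_def)
  have block: "finite (block K e)" "card (block K e) = ?n + 2" if "e \<in> edges G" for e
    using e2[OF that] finK by (simp_all add: finite_block card_block)
  show "\<exists>f. weak_IASI (G \<diamondop> K) f \<and>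
      card (edges G) * (Suc ?n choose 2) = card {d \<in> edges (G \<diamondop> K). mono_indexed f d}"
  proof -
    obtain w where w: "w \<in> verts K"
      using assms(4) by blast
    define I :: "('a + 'a set \<times> 'b) set" where "I = range (\<lambda>e. Inr (e, w))"
    have "u \<notin> I \<or> v \<notin> I" if "{u, v} \<in> edges (G \<diamondop> K)" for u v
      using that edges_edge_corona[OF assms(1,3)] by (auto simp: I_def)
    then obtain f where f: "weak_IASI (G \<diamondop> K) f" and f1: "\<And>x. card (f x) = 1 \<longleftrightarrow> x \<notin> I"
      using weak_IASI_of_independent[OF corona, of I] by blast
    have "card {x \<in> block K e. card (f x) = 1} = Suc ?n" if "e \<in> edges G" for e
    proof -
      have "{x \<in> block K e. card (f x) = 1} = block K e - {Inr (e, w)}"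
        unfolding f1 I_def by auto
      then show ?thesis
        using block[OF that] w by simp
    qed
    then have "card {d \<in> edges (G \<diamondop> K). mono_indexed f d} = card (edges G) * (Suc ?n choose 2)"
      using card_mono_indexed_edge_corona[OF assms(1-3) f] by simp
    with f show ?thesis by auto
  qed
  show "card (edges G) * (Suc ?n choose 2) \<le> k"
    if k: "\<exists>f. weak_IASI (G \<diamondop> K) f \<and> k = card {d \<in> edges (G \<diamondop> K). mono_indexed f d}" for k
  proof -
    obtain f where f: "weak_IASI (G \<diamondop> K) f"
      and k: "k = card {d \<in> edges (G \<diamondop> K). mono_indexed f d}"
      using k by blast
    have "(Suc ?n choose 2) \<le> (card {x \<in> block K e. card (f x) = 1} choose 2)"
      if e: "e \<in> edges G" for e
    proof (rule binomial_right_mono)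
      let ?T = "{x \<in> block K e. card (f x) \<noteq> 1}"
      have "x = y" if "x \<in> ?T" "y \<in> ?T" for x y
      proof (rule ccontr)
        assume "x \<noteq> y"
        with that e have "{x, y} \<in> edges (G \<diamondop> K)"
          unfolding edges_edge_corona[OF assms(1,3)] by auto
        then show False
          using weak_IASI_adjacent[OF corona f] that by blast
      qed
      moreover have finT: "finite ?T"
        using block(1)[OF e] by simp
      ultimately have "card ?T \<le> 1"
        by (simp add: card_le_Suc0_iff_eq)
      moreover have "card (block K e) = card {x \<in> block K e. card (f x) = 1} + card ?T"
        using block(1)[OF e]
        by (subst card_Un_disjoint[symmetric]) (auto intro: arg_cong[where f = card])
      ultimately show "Suc ?n \<le> card {x \<in> block K e. card (f x) = 1}"
        using block(2)[OF e] by linarith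
    qed
    then have "(\<Sum>e\<in>edges G. Suc ?n choose 2)
        \<le> (\<Sum>e\<in>edges G. card {x \<in> block K e. card (f x) = 1} choose 2)"
      by (rule sum_mono)
    then show ?thesis
      using k card_mono_indexed_edge_corona[OF assms(1-3) f] by simp
  qed
qed

theorem theorem2p13:
  fixes G :: "'a ugraph" and K :: "'b ugraph" and r m n :: nat
  assumes "graph G" and "regular r G" and "card (verts G) = m"
    and "graph K" and "complete_graph K" and "card (verts K) = n"
    and "r + 1 \<le> n"
  shows "real (sparing_number (G \<diamondop> K)) = 1 / 4 * real r * real m * real n * (real n + 1)"
proof -
  have "verts K \<noteq> {}"
    using assms(6,7) by auto
  then have "sparing_number (G \<diamondop> K) = card (edges G) * (Suc n choose 2)"
    using sparing_number_edge_corona_complete[OF assms(1,4,5)] assms(6) by simp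
  moreover have "2 * (Suc n choose 2) = n * (n + 1)"
    by (simp add: choose_two)
  moreover have "2 * card (edges G) = r * m"
    using regular_handshake[OF assms(1,2)] assms(3) by simp
  moreover have "4 * (card (edges G) * (Suc n choose 2))
      = (2 * card (edges G)) * (2 * (Suc n choose 2))"
    by simp
  ultimately have "4 * sparing_number (G \<diamondop> K) = r * m * (n * (n + 1))"
    by metis
  then have "real (4 * sparing_number (G \<diamondop> K)) = real (r * m * (n * (n + 1)))"
    by (rule arg_cong)
  then show ?thesis
    by (simp add: algebra_simps)
qed

end
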